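(* Let $(E,+,\leq)$ be a nontrivial linearly ordered monoid which is non-Archimedean, in the sense that the following condition fails: $$\exists\, u\in E_+ \ \ \forall\, x\in E\ \ \exists\, n\in\mathbb{N}:\ \ n u\geq x .$$ Then the semigroup $(E,+)$ is a hyperspace.
   Context: A partially ordered monoid $(E,+,\leq)$ is a monoid $(E,+)$, with neutral element $0$, equipped with a partial order $\leq$ compatible with $+$; in particular $x,y\in E_+$ implies $x+y\in E_+$, where $E_+=\{x\in E : x\geq 0\}$. It is linearly ordered if $\leq$ is a linear (total) order. Nontrivial means $E\neq\{0\}$. For $n\in\mathbb{N}$ and $u\in E$, $nu$ denotes the $n$-fold sum $u+\cdots+u$ (with $0u=0$). Two sub-semigroups of a semigroup $(E,* )$ are called disjoint if and only if their intersection is empty or is a set of idempotent elements (elements $e$ with $e*e=e$). A semigroup $(E,* )$ is called a hyperspace if and only if it contains a sub-semigroup $F\subsetneqq E$ together with an infinite set $\mathcal{I}$ of pairwise disjoint (in the sense that the intersection of any two distinct members of $\mathcal{I}$ is empty or is a set of idempotent elements) sub-semigroups $I\subsetneqq F$. *)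

theory Defs
  imports Main
begin

(* The classes ordered_ab_semigroup_add and ordered_comm_monoid_add of HOL.Groups
   assume commutativity, which is not required here; hence monotonicity of + is
   required in both arguments. *)
class partially_ordered_monoid = monoid_add + order +
  assumes plus_left_mono: "a \<le> b \<Longrightarrow> c + a \<le> c + b"
    and plus_right_mono: "a \<le> b \<Longrightarrow> a + c \<le> b + c"

class linearly_ordered_monoid = partially_ordered_monoid + linorder

(* The empty set is not counted as a sub-semigroup. For hyperspace below this choice
   is immaterial: F has a proper subset, hence is nonempty, and at most one member of \<I>
   is empty. *)
definition sub_semigroup :: "('a \<Rightarrow> 'a \<Rightarrow> 'a) \<Rightarrow> 'a set \<Rightarrow> bool" where
  "sub_semigroup f A \<longleftrightarrow> A \<noteq> {} \<and> (\<forall>x\<in>A. \<forall>y\<in>A. f x y \<in> A)"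

definition disjoint_semigroups :: "('a \<Rightarrow> 'a \<Rightarrow> 'a) \<Rightarrow> 'a set \<Rightarrow> 'a set \<Rightarrow> bool" where
  "disjoint_semigroups f A B \<longleftrightarrow> A \<inter> B = {} \<or> (\<forall>e\<in>A \<inter> B. f e e = e)"

(* The ambient semigroup is the whole type, so the condition that F is a proper
   subset of E reads F \<subset> UNIV. *)
definition hyperspace :: "('a \<Rightarrow> 'a \<Rightarrow> 'a) \<Rightarrow> bool" where
  "hyperspace f \<longleftrightarrow> semigroup f \<and>
     (\<exists>F. sub_semigroup f F \<and> F \<subset> UNIV \<and>
       (\<exists>\<I>. infinite \<I> \<and> (\<forall>I\<in>\<I>. sub_semigroup f I \<and> I \<subset> F) \<and>
         pairwise (disjoint_semigroups f) \<I>))"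

(* The n-fold sum u + ... + u; HOL.Groups has no such operation on monoid_add. *)
definition nsum :: "nat \<Rightarrow> 'a::monoid_add \<Rightarrow> 'a" where
  "nsum n u = sum_list (replicate n u)"

end

(* Call x dominant over u if every multiple of u is strictly below x. The failure of the
   Archimedean condition lets one start at 0 and choose 0 < x 0 < x 1 < ... with each term
   dominant over the previous ones, so the cyclic sub-semigroups generated by the x k are
   pairwise disjoint. They all lie in the sub-semigroup of elements above x 0, which is
   proper because it misses 0. *)
theory Submission
  imports Defs
begin

lemma nsum_0 [simp]: "nsum 0 u = 0"
  and nsum_Suc [simp]: "nsum (Suc n) u = u + nsum n u"
  by (simp_all add: nsum_def)

lemma nsum_add: "nsum (m + n) u = nsum m u + nsum n u"
  by (simp add: nsum_def replicate_add)

lemma nsum_nonneg: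
  fixes u :: "'a::partially_ordered_monoid"
  assumes "0 \<le> u"
  shows "0 \<le> nsum n u"
proof (induction n)
  case (Suc n)
  have "u + 0 \<le> u + nsum n u"
    using Suc by (rule plus_left_mono)
  then show ?case
    using assms by simp
qed simp

lemma le_nsum_Suc:
  fixes u :: "'a::partially_ordered_monoid"
  assumes "0 \<le> u"
  shows "u \<le> nsum (Suc n) u"
  using plus_left_mono [OF nsum_nonneg [OF assms], of u n] by simp

lemma sub_semigroup_multiples: "sub_semigroup (+) (range (\<lambda>n. nsum (Suc n) u))"
proof -
  have "nsum (Suc m) u + nsum (Suc n) u \<in> range (\<lambda>n. nsum (Suc n) u)" for m n
    using nsum_add [of "Suc m" "Suc n" u] by (metis add_Suc_right rangeI)
  then show ?thesis
    unfolding sub_semigroup_def by blast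
qed

lemma sub_semigroup_atLeast:
  fixes a :: "'a::partially_ordered_monoid"
  assumes "0 \<le> a"
  shows "sub_semigroup (+) {a..}"
proof -
  have "a \<le> x + y" if "a \<le> x" "a \<le> y" for x y
  proof -
    have "x + 0 \<le> x + y"
      using assms that by (intro plus_left_mono) simp
    then show ?thesis
      using that by simp
  qed
  then show ?thesis
    by (auto simp: sub_semigroup_def)
qed

text \<open>Dependent choice only controls consecutive terms: it makes \<open>x (Suc k)\<close>
  dominant over \<open>x k\<close>. Monotonicity of \<open>x\<close> then carries this over to every
  later index.\<close>

lemma dominating_sequence:
  assumes "\<not> (\<exists>u::'a::linearly_ordered_monoid. u \<ge> 0 \<and> (\<forall>x. \<exists>n. nsum n u \<ge> x))"
  obtains x :: "nat \<Rightarrow> 'a::linearly_ordered_monoid"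
  where "\<And>k. 0 < x k" "\<And>i j n. i < j \<Longrightarrow> nsum n (x i) < x j"
proof -
  \<comment> \<open>The order is total, so a \<open>y\<close> that is below no multiple of
    \<open>u\<close> is strictly above all of them.\<close>
  have ex: "\<exists>y. \<forall>n. nsum n u < y" if "0 \<le> u" for u :: 'a
    using assms that by (metis not_le)
  have "\<exists>x::nat \<Rightarrow> 'a. \<forall>k. 0 < x k \<and> (\<forall>n. nsum n (x k) < x (Suc k))"
  proof (rule dependent_nat_choice)
    show "\<exists>y::'a. 0 < y"
      using ex [of 0] by (metis order.refl nsum_0)
    \<comment> \<open>Positivity of the new term is the case \<open>n = 0\<close> of its
      dominance.\<close>
    show "\<exists>y. 0 < y \<and> (\<forall>n. nsum n u < y)" if "0 < u" for u :: 'a and k :: nat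
      using ex [of u] that by (metis order.strict_implies_order nsum_0)
  qed
  then obtain x :: "nat \<Rightarrow> 'a"
    where pos: "\<And>k. 0 < x k" and dom: "\<And>k n. nsum n (x k) < x (Suc k)"
    by blast
  have "x k < x (Suc k)" for k
    using dom [of 1 k] by simp
  then have "mono x"
    by (intro strict_mono_mono strict_mono_Suc_iff [THEN iffD2]) blast
  then have "nsum n (x i) < x j" if "i < j" for i j n
    using dom [of n i] monoD [of x "Suc i" j] that by fastforce
  with pos show thesis
    by (rule that)
qed

theorem theorem4p1:
  assumes nontrivial: "(UNIV :: 'a::linearly_ordered_monoid set) \<noteq> {0}"
    and non_archimedean:
      "\<not> (\<exists>u::'a. u \<ge> 0 \<and> (\<forall>x::'a. \<exists>n::nat. nsum n u \<ge> x))"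
  shows "hyperspace ((+) :: 'a \<Rightarrow> 'a \<Rightarrow> 'a)"
proof -
  obtain x :: "nat \<Rightarrow> 'a"
    where pos: "\<And>k. 0 < x k" and dom: "\<And>i j n. i < j \<Longrightarrow> nsum n (x i) < x j"
    using dominating_sequence [OF non_archimedean] by blast
  \<comment> \<open>The shift by \<open>Suc\<close> leaves out the empty sum 0, which lies strictly
    below \<open>x 0\<close> and so outside \<open>{x 0..}\<close>.\<close>
  define I where "I k = range (\<lambda>n. nsum (Suc n) (x k))" for k
  have x_le: "x k \<le> y" if "y \<in> I k" for k y
    using that le_nsum_Suc [of "x k"] pos [of k] unfolding I_def by (auto simp: less_imp_le)
  have x_in: "x k \<in> I k" for k
    unfolding I_def by (rule range_eqI [of _ _ 0]) simp
  have less_x: "y < x j" if "y \<in> I i" "i < j" for i j y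
    using that dom unfolding I_def by blast
  \<comment> \<open>The element \<open>x j\<close> separates the two sets: it is a lower bound of
    \<open>I j\<close> and strictly above all of \<open>I i\<close>.\<close>
  have disj_less: "I i \<inter> I j = {}" if "i < j" for i j
    using x_le less_x [OF _ that] by (meson disjoint_iff not_le)
  then have disj: "I i \<inter> I j = {}" if "i \<noteq> j" for i j
    using that by (metis Int_commute linorder_neqE_nat)
  \<comment> \<open>Two equal members with different indices would be disjoint from themselves,
    hence empty, but \<open>I k\<close> contains \<open>x k\<close>.\<close>
  have "inj I"
    using disj x_in by (metis Int_absorb empty_iff injI)
  then have "infinite (range I)"
    by (simp add: finite_image_iff)
  moreover have "\<forall>J\<in>range I. sub_semigroup (+) J \<and> J \<subset> {x 0..}"
  proof (intro ballI conjI; elim rangeE; hypsubst)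
    fix k
    show "sub_semigroup (+) (I k)"
      unfolding I_def by (rule sub_semigroup_multiples)
    have x0_le: "x 0 \<le> x j" for j
      using dom [of 0 j 1] by (cases j) auto
    have "I k \<subseteq> {x 0..}"
      using x0_le x_le by (meson atLeast_iff order_trans subsetI)
    \<comment> \<open>The generator of the next member witnesses that the inclusion in
      \<open>{x 0..}\<close> is proper.\<close>
    moreover have "x (Suc k) \<notin> I k"
      using disj [of k "Suc k"] x_in [of "Suc k"] by auto
    moreover have "x (Suc k) \<in> {x 0..}"
      using x0_le by simp
    ultimately show "I k \<subset> {x 0..}"
      by blast
  qed
  moreover have "pairwise (disjoint_semigroups (+)) (range I)"
    unfolding pairwise_def disjoint_semigroups_def using disj by (metis (no_types, lifting) rangeE)
  moreover have "sub_semigroup (+) {x 0..}"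
    using pos [of 0] by (intro sub_semigroup_atLeast) simp
  moreover have "{x 0..} \<subset> UNIV"
    using pos [of 0] by (metis UNIV_I atLeast_iff not_le psubsetI subset_UNIV)
  moreover have "semigroup ((+) :: 'a \<Rightarrow> 'a \<Rightarrow> 'a)"
    by (rule add.semigroup_axioms)
  ultimately show ?thesis
    unfolding hyperspace_def by (intro conjI exI [of _ "{x 0..}"] exI [of _ "range I"])
qed

end
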